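(* Let $p_1,\ldots,p_r\in\mathbb{R}[X_1,\ldots,X_n]$ be such that $S=\{x\in\mathbb{R}^n\mid p_1(x)\ge 0,\ldots,p_r(x)\ge 0\}$ is convex and has non-empty interior. If $S$ has a non-exposed face, then for all $d$ the Lasserre relaxation $\mathscr{L}(\underline p)_d$ strictly contains $S$.
   Context: Write $\underline X=(X_1,\ldots,X_n)$, and let $\mathbb{R}[\underline X]_d$ be the space of real polynomials of degree at most $d$. For $\underline p=(p_1,\ldots,p_r)$ define the truncated quadratic module $\mathrm{QM}(\underline p)_d=\{\sigma_0+\sigma_1p_1+\cdots+\sigma_rp_r\mid \sigma_i\in\sum(\mathbb{R}[\underline X]_d)^2\}$, where $\sum(\mathbb{R}[\underline X]_d)^2$ is the set of finite sums of squares of elements of $\mathbb{R}[\underline X]_d$. The degree $d$ Lasserre relaxation is $\mathscr{L}(\underline p)_d=\{x\in\mathbb{R}^n\mid \ell(x)\ge 0 \text{ for all } \ell\in \mathrm{QM}(\underline p)_d\cap\mathbb{R}[\underline X]_1\}$. A face of a convex set $S$ is a nonempty convex subset $F\subseteq S$ such that whenever $\lambda x+(1-\lambda)y\in F$ for some $x,y\in S$, $\lambda\in(0,1)$, then $x,y\in F$. A face is exposed if it is of the form $\{x\in S\mid \ell(x)=0\}$ for some affine linear polynomial $\ell\in\mathbb{R}[\underline X]_1$ that is nonnegative on $S$ (in particular $S$ itself is exposed, via $\ell=0$). *)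

theory Defs
  imports "HOL-Analysis.Analysis" "HOL-Library.Poly_Mapping"
begin

text \<open>
  Real polynomials in finitely many variables indexed by \<open>'n\<close>: a polynomial maps each monomial
  (its exponent vector) to its coefficient. The ring structure, with convolution as
  multiplication, is the one of \<^theory>\<open>HOL-Library.Poly_Mapping\<close>.
\<close>

type_synonym 'n rpoly = "('n \<Rightarrow>\<^sub>0 nat) \<Rightarrow>\<^sub>0 real"

definition peval :: "'n::finite rpoly \<Rightarrow> real ^ 'n \<Rightarrow> real" where
  "peval p x = (\<Sum>m\<in>Poly_Mapping.keys p.
     Poly_Mapping.lookup p m * (\<Prod>i\<in>UNIV. (x $ i) ^ Poly_Mapping.lookup m i))"

definition polys_upto :: "nat \<Rightarrow> 'n::finite rpoly set" where
  "polys_upto d = {p. \<forall>m\<in>Poly_Mapping.keys p. (\<Sum>i\<in>UNIV. Poly_Mapping.lookup m i) \<le> d}"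

definition sos_upto :: "nat \<Rightarrow> 'n::finite rpoly set" where
  "sos_upto d = {\<Sum>q\<leftarrow>qs. q\<^sup>2 | qs. set qs \<subseteq> polys_upto d}"

text \<open>
  The generators \<open>p\<^sub>1, \<dots>, p\<^sub>r\<close> form a list (indexed from 0). The degree bound \<open>d\<close> restricts the
  polynomials that are squared, not the degree of the products.
\<close>

definition quadratic_module :: "'n::finite rpoly list \<Rightarrow> nat \<Rightarrow> 'n rpoly set" where
  "quadratic_module ps d =
     {\<sigma>0 + (\<Sum>i<length ps. \<sigma> i * ps ! i) | \<sigma>0 \<sigma>.
        \<sigma>0 \<in> sos_upto d \<and> (\<forall>i<length ps. \<sigma> i \<in> sos_upto d)}"

definition lasserre :: "'n::finite rpoly list \<Rightarrow> nat \<Rightarrow> (real ^ 'n) set" where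
  "lasserre ps d = {x. \<forall>l \<in> quadratic_module ps d \<inter> polys_upto 1. peval l x \<ge> 0}"

definition basic_closed_set :: "'n::finite rpoly list \<Rightarrow> (real ^ 'n) set" where
  "basic_closed_set ps = {x. \<forall>p\<in>set ps. peval p x \<ge> 0}"

text \<open>
  The library's \<^const>\<open>face_of\<close> and \<^const>\<open>exposed_face_of\<close> also admit the empty set, which
  is not a face here. For nonempty \<open>F\<close>, the supporting hyperplane condition \<open>a \<bullet> x \<le> b\<close> on \<open>S\<close> of
  \<^const>\<open>exposed_face_of\<close> is nonnegativity of the affine linear polynomial
  \<open>b - a \<bullet> x\<close> on \<open>S\<close>; \<open>a = 0\<close> is allowed, so \<open>S\<close> itself is exposed.
\<close>

definition has_nonexposed_face :: "(real ^ 'n::finite) set \<Rightarrow> bool" where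
  "has_nonexposed_face S \<longleftrightarrow> (\<exists>F. F \<noteq> {} \<and> F face_of S \<and> \<not> F exposed_face_of S)"

end

theory Submission
  imports Defs
begin

text \<open>
  Let \<open>F\<close> be a non-exposed face of \<open>S\<close> and \<open>x\<close> a relative interior point of \<open>F\<close>. There is a
  \<open>y \<in> S - F\<close> at which every affine function that is nonnegative on \<open>S\<close> and vanishes on \<open>F\<close> vanishes,
  since otherwise \<open>F\<close> would be an intersection of exposed faces. If \<open>p\<^sub>i\<close> vanishes at \<open>x\<close>, its
  differential at \<open>x\<close> is such a function, so the derivative of \<open>p\<^sub>i\<close> at \<open>x\<close> in direction \<open>v = y - x\<close> is 0.

  For \<open>t > 0\<close> the point \<open>x - t v\<close> is not in \<open>S\<close>. If the relaxation of degree \<open>d\<close> equalled \<open>S\<close>, some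
  affine member of the truncated quadratic module would be negative there, so along the line
  \<open>s \<mapsto> x + s v\<close> it would be \<open>a + b s\<close> with \<open>0 \<le> a < b t\<close>. All terms of the representation are
  nonnegative on \<open>[0, 1]\<close>, so at \<open>s = 0\<close> they are at most \<open>b t\<close>. As the degrees are bounded, this
  forces the derivative of each of them at \<open>s = 0\<close> to be at most \<open>o(1) b\<close> as \<open>t\<close> tends to 0, whereas
  these derivatives sum up to \<open>b\<close>.
\<close>

section \<open>Evaluation of multivariate polynomials\<close>

lemma peval_superset:
  assumes "finite A" "Poly_Mapping.keys p \<subseteq> A"
  shows "peval p x = (\<Sum>m\<in>A. Poly_Mapping.lookup p m * (\<Prod>i\<in>UNIV. (x $ i) ^ Poly_Mapping.lookup m i))"
  unfolding peval_def
  by (rule sum.mono_neutral_left) (use assms in \<open>auto simp: in_keys_iff\<close>)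

lemma peval_0 [simp]: "peval 0 x = 0"
  by (simp add: peval_def)

lemma peval_1 [simp]: "peval 1 x = 1"
  by (simp add: peval_def flip: single_one)

lemma peval_add [simp]: "peval (p + q) x = peval p x + peval q x"
proof -
  let ?A = "Poly_Mapping.keys p \<union> Poly_Mapping.keys q"
  have "peval r x = (\<Sum>m\<in>?A. Poly_Mapping.lookup r m * (\<Prod>i\<in>UNIV. (x $ i) ^ Poly_Mapping.lookup m i))"
    if "r \<in> {p, q, p + q}" for r
    by (rule peval_superset) (use that keys_add[of p q] in auto)
  then show ?thesis
    by (simp add: lookup_add ring_distribs sum.distrib)
qed

lemma peval_sum: "peval (sum f A) x = (\<Sum>a\<in>A. peval (f a) x)"
  by (induction A rule: infinite_finite_induct) auto

lemma peval_sum_list: "peval (\<Sum>a\<leftarrow>as. f a) x = (\<Sum>a\<leftarrow>as. peval (f a) x)"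
  by (induction as) auto

lemma peval_single:
  "peval (Poly_Mapping.single m c) x = c * (\<Prod>i\<in>UNIV. (x $ i) ^ Poly_Mapping.lookup m i)"
  by (simp add: peval_def)

lemma rpoly_eq_sum_single:
  fixes p :: "'n rpoly"
  shows "p = (\<Sum>m\<in>Poly_Mapping.keys p. Poly_Mapping.single m (Poly_Mapping.lookup p m))"
proof (rule poly_mapping_eqI)
  fix k
  have "Poly_Mapping.lookup (\<Sum>m\<in>Poly_Mapping.keys p. Poly_Mapping.single m (Poly_Mapping.lookup p m)) k
      = (\<Sum>m\<in>Poly_Mapping.keys p. if m = k then Poly_Mapping.lookup p m else 0)"
    by (simp add: lookup_sum lookup_single when_def)
  also have "\<dots> = Poly_Mapping.lookup p k"
    by (simp add: in_keys_iff)
  finally show "Poly_Mapping.lookup p k = Poly_Mapping.lookup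
      (\<Sum>m\<in>Poly_Mapping.keys p. Poly_Mapping.single m (Poly_Mapping.lookup p m)) k" ..
qed

text \<open>Expanding both factors into monomials reduces this to single monomials, where exponents
  add.\<close>

lemma peval_mult [simp]: "peval (p * q) x = peval p x * peval q x"
proof -
  have "peval (p * q) x = peval
      ((\<Sum>m\<in>Poly_Mapping.keys p. Poly_Mapping.single m (Poly_Mapping.lookup p m)) *
       (\<Sum>m\<in>Poly_Mapping.keys q. Poly_Mapping.single m (Poly_Mapping.lookup q m))) x"
    by (simp flip: rpoly_eq_sum_single)
  also have "\<dots> = (\<Sum>m\<in>Poly_Mapping.keys p. \<Sum>k\<in>Poly_Mapping.keys q.
      peval (Poly_Mapping.single m (Poly_Mapping.lookup p m)) x *
      peval (Poly_Mapping.single k (Poly_Mapping.lookup q k)) x)"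
    by (simp add: sum_product peval_sum mult_single peval_single lookup_add power_add prod.distrib mult_ac)
  also have "\<dots> = peval p x * peval q x"
    by (simp add: sum_product peval_single peval_def[of p] peval_def[of q])
  finally show ?thesis .
qed

lemma peval_power [simp]: "peval (p ^ k) x = peval p x ^ k"
  by (induction k) auto

lemma peval_has_gradient:
  obtains a where "((peval p) has_derivative (\<lambda>h. a \<bullet> h)) (at x)"
proof -
  have nth: "((\<lambda>y. y $ i) has_derivative (\<lambda>h. h $ i)) (at x)" for i
    by (rule bounded_linear_imp_has_derivative) (rule bounded_linear_vec_nth)
  have "\<exists>D. ((\<lambda>y. \<Prod>i\<in>UNIV. (y $ i) ^ Poly_Mapping.lookup m i) has_derivative D) (at x)" for m
    by (rule exI, rule has_derivative_prod, rule has_derivative_power, rule nth)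
  then obtain E where
    E: "((\<lambda>y. \<Prod>i\<in>UNIV. (y $ i) ^ Poly_Mapping.lookup m i) has_derivative E m) (at x)" for m
    by metis
  have "\<exists>D. ((peval p) has_derivative D) (at x)"
    unfolding peval_def[abs_def]
    by (rule exI, rule has_derivative_sum, rule has_derivative_mult_right, rule E)
  then obtain D where D: "((peval p) has_derivative D) (at x)" ..
  \<comment> \<open>A linear functional is the inner product with the value at 1 of its adjoint;
    that vector is the gradient.\<close>
  then have "D = (\<lambda>h. adjoint D 1 \<bullet> h)"
    using adjoint_works[OF has_derivative_linear[OF D], of _ 1] by (simp add: inner_commute fun_eq_iff)
  with D that[of "adjoint D 1"] show thesis by simp
qed

section \<open>Restriction to a line\<close>

text \<open>The restriction of \<open>p\<close> to the line through \<open>x\<close> in direction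
  \<open>v\<close>, kept as a univariate polynomial so that degree bounds and interpolation
  apply.\<close>

definition line_poly :: "real ^ 'n::finite \<Rightarrow> real ^ 'n \<Rightarrow> 'n rpoly \<Rightarrow> real poly" where
  "line_poly x v p = (\<Sum>m\<in>Poly_Mapping.keys p.
     smult (Poly_Mapping.lookup p m) (\<Prod>i\<in>UNIV. [:x $ i, v $ i:] ^ Poly_Mapping.lookup m i))"

lemma poly_line_poly: "poly (line_poly x v p) s = peval p (x + s *\<^sub>R v)"
  by (simp add: line_poly_def peval_def poly_sum poly_prod)

lemma degree_line_poly_le:
  assumes "p \<in> polys_upto d"
  shows "degree (line_poly x v p) \<le> d"
  unfolding line_poly_def
proof (rule degree_sum_le)
  fix m assume "m \<in> Poly_Mapping.keys p"
  then have "(\<Sum>i\<in>UNIV. Poly_Mapping.lookup m i) \<le> d"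
    using assms by (auto simp: polys_upto_def)
  moreover have "degree ([:x $ i, v $ i:] ^ k) \<le> k" for i k
    by (rule order_trans[OF degree_power_le]) simp
  then have "degree (\<Prod>i\<in>UNIV. [:x $ i, v $ i:] ^ Poly_Mapping.lookup m i)
      \<le> (\<Sum>i\<in>UNIV. Poly_Mapping.lookup m i)"
    by (intro order_trans[OF degree_prod_sum_le] sum_mono) auto
  ultimately show "degree (smult (Poly_Mapping.lookup p m)
      (\<Prod>i\<in>UNIV. [:x $ i, v $ i:] ^ Poly_Mapping.lookup m i)) \<le> d"
    by (auto simp del: degree_smult_eq intro!: order_trans[OF degree_smult_le])
qed simp

lemma pderiv_line_poly_0:
  assumes "((peval p) has_derivative (\<lambda>h. a \<bullet> h)) (at x)"
  shows "poly (pderiv (line_poly x v p)) 0 = a \<bullet> v"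
proof -
  have "((\<lambda>s. x + s *\<^sub>R v) has_derivative (\<lambda>s. s *\<^sub>R v)) (at 0)"
    by (auto intro!: derivative_eq_intros)
  then have "((\<lambda>s. peval p (x + s *\<^sub>R v)) has_derivative (\<lambda>s. a \<bullet> (s *\<^sub>R v))) (at 0)"
    by (rule has_derivative_compose) (use assms in simp)
  then have "((\<lambda>s. peval p (x + s *\<^sub>R v)) has_real_derivative a \<bullet> v) (at 0)"
    by (simp add: has_field_derivative_def mult_commute_abs)
  moreover have "poly (line_poly x v p) = (\<lambda>s. peval p (x + s *\<^sub>R v))"
    by (rule ext) (rule poly_line_poly)
  ultimately have "(poly (line_poly x v p) has_real_derivative a \<bullet> v) (at 0)"
    by simp
  with poly_DERIV show ?thesis
    by (rule DERIV_unique)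
qed

section \<open>Derivatives of weighted sums of squares\<close>

text \<open>Lagrange interpolation at the points of \<open>A\<close> turns the derivative at 0 into a linear
  combination of the values on \<open>A\<close>.\<close>

lemma pderiv_square_le_values:
  fixes A :: "real set"
  assumes "finite A" "d < card A"
  obtains C where "0 \<le> C"
    "\<And>q. degree q \<le> d \<Longrightarrow> (poly (pderiv q) 0)\<^sup>2 \<le> C * (\<Sum>s\<in>A. (poly q s)\<^sup>2)"
proof -
  \<comment> \<open>\<open>L s\<close> is the Lagrange basis polynomial of the node
    \<open>s\<close>; \<open>C\<close> is the factor that Cauchy-Schwarz produces from the
    derivatives of the \<open>L s\<close> at 0.\<close>
  define L where "L s = (\<Prod>r\<in>A - {s}. smult (1 / (s - r)) [:- r, 1:])" for s
  define C where "C = (\<Sum>s\<in>A. (poly (pderiv (L s)) 0)\<^sup>2)"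
  have L: "poly (L s) u = (if u = s then 1 else 0)" if "s \<in> A" "u \<in> A" for s u
    using that \<open>finite A\<close>
    by (auto simp: L_def poly_prod prod_zero_iff simp flip: diff_divide_distrib intro!: prod.neutral)
  have degL: "degree (L s) \<le> card A - 1" if "s \<in> A" for s
  proof -
    have "degree (L s) \<le> (\<Sum>r\<in>A - {s}. 1)"
      unfolding L_def using \<open>finite A\<close>
      by (intro order_trans[OF degree_prod_sum_le] sum_mono) auto
    also have "\<dots> = card A - 1"
      using that \<open>finite A\<close> by simp
    finally show ?thesis .
  qed
  have "(poly (pderiv q) 0)\<^sup>2 \<le> C * (\<Sum>s\<in>A. (poly q s)\<^sup>2)" if "degree q \<le> d" for q
  proof -
    \<comment> \<open>Both sides have degree below \<open>card A\<close> and agree on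
      \<open>A\<close>.\<close>
    have "q = (\<Sum>s\<in>A. smult (poly q s) (L s))"
    proof (rule poly_eqI_degree)
      fix u assume "u \<in> A"
      then have "poly (\<Sum>s\<in>A. smult (poly q s) (L s)) u = (\<Sum>s\<in>A. if u = s then poly q s else 0)"
        by (auto simp: poly_sum L intro!: sum.cong)
      also have "\<dots> = poly q u"
        using \<open>u \<in> A\<close> \<open>finite A\<close> by simp
      finally show "poly q u = poly (\<Sum>s\<in>A. smult (poly q s) (L s)) u" ..
    next
      have "degree (\<Sum>s\<in>A. smult (poly q s) (L s)) \<le> card A - 1"
        using \<open>finite A\<close> degL by (intro degree_sum_le) (auto intro: order_trans[OF degree_smult_le])
      then show "degree (\<Sum>s\<in>A. smult (poly q s) (L s)) < card A"
        using assms by simp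
    qed (use that assms in simp)
    then have "pderiv q = (\<Sum>s\<in>A. smult (poly q s) (pderiv (L s)))"
      using higher_pderiv_sum[of 1 "\<lambda>s. smult (poly q s) (L s)" A] by (simp add: pderiv_smult)
    then have "poly (pderiv q) 0 = (\<Sum>s\<in>A. poly (pderiv (L s)) 0 * poly q s)"
      by (simp add: poly_sum mult.commute)
    then show ?thesis
      unfolding C_def by (simp only: Cauchy_Schwarz_ineq_sum)
  qed
  moreover have "0 \<le> C"
    by (simp add: C_def sum_nonneg)
  ultimately show thesis
    using that by blast
qed

lemma poly_sum_squares_nonneg: "0 \<le> poly (\<Sum>q\<leftarrow>qs. q\<^sup>2) (s :: real)"
  by (induction qs) auto

text \<open>Each square contributes \<open>2 * (u * w)\<close>, with \<open>u\<close> a value and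
  \<open>w\<close> a derivative, and \<open>0 \<le> (u - e * w)\<^sup>2\<close> bounds it. The
  weight \<open>e\<close> trades the two resulting terms off against each other.\<close>

lemma pderiv_sum_squares_le:
  fixes e :: real
  assumes "0 < e"
  shows "poly (pderiv (\<Sum>q\<leftarrow>qs. q\<^sup>2)) x
    \<le> poly (\<Sum>q\<leftarrow>qs. q\<^sup>2) x / e + e * (\<Sum>q\<leftarrow>qs. (poly (pderiv q) x)\<^sup>2)"
proof (induction qs)
  case (Cons q qs)
  define u w where "u = poly q x" and "w = poly (pderiv q) x"
  have "0 \<le> (u - e * w)\<^sup>2 / e"
    using assms by simp
  also have "\<dots> = u\<^sup>2 / e + e * w\<^sup>2 - 2 * (u * w)"
    using assms by (simp add: field_simps power2_eq_square)
  finally have "poly (pderiv (q\<^sup>2)) x \<le> u\<^sup>2 / e + e * w\<^sup>2"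
    by (simp add: power2_eq_square pderiv_mult u_def w_def)
  with Cons show ?case
    by (simp add: pderiv_add ring_distribs add_divide_distrib u_def w_def)
qed simp

text \<open>The constant \<open>C\<close> survives summation, so the estimate is independent of the
  number of squares, which is not bounded.\<close>

lemma sum_squares_pderiv_le:
  assumes "\<And>q. q \<in> set qs \<Longrightarrow> (poly (pderiv q) 0)\<^sup>2 \<le> C * (\<Sum>s\<in>A. (poly q s)\<^sup>2)"
  shows "(\<Sum>q\<leftarrow>qs. (poly (pderiv q) 0)\<^sup>2) \<le> C * (\<Sum>s\<in>A. poly (\<Sum>q\<leftarrow>qs. q\<^sup>2) (s :: real))"
  using assms
proof (induction qs)
  case (Cons q qs)
  have "(poly (pderiv q) 0)\<^sup>2 \<le> C * (\<Sum>s\<in>A. (poly q s)\<^sup>2)"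
    by (rule Cons.prems) simp
  moreover have "(\<Sum>q\<leftarrow>qs. (poly (pderiv q) 0)\<^sup>2) \<le> C * (\<Sum>s\<in>A. poly (\<Sum>q\<leftarrow>qs. q\<^sup>2) s)"
    by (rule Cons.IH) (rule Cons.prems, simp)
  ultimately show ?case
    by (simp add: sum.distrib ring_distribs)
qed simp

text \<open>If \<open>g\<close> vanishes at 0, so does its derivative, and the product rule gives 0.
  Otherwise \<open>g\<close> is bounded below near 0, so the sum of squares is O(b) at
  \<open>d + 1\<close> nodes there and O(b t) at 0, which makes its derivative at 0 small against
  \<open>b\<close>. The threshold for \<open>t\<close> is uniform in \<open>qs\<close> and
  \<open>b\<close>.\<close>

lemma weighted_sos_pderiv_small:
  fixes g :: "real poly" and \<eta> :: real
  assumes "0 \<le> poly g 0" and crit: "poly g 0 = 0 \<Longrightarrow> poly (pderiv g) 0 = 0" and "0 < \<eta>"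
  shows "\<forall>\<^sub>F t in at_right 0. \<forall>qs b. 0 < b \<longrightarrow> (\<forall>q\<in>set qs. degree q \<le> d) \<longrightarrow>
    (\<forall>s\<in>{0..1}. poly ((\<Sum>q\<leftarrow>qs. q\<^sup>2) * g) s \<le> b * (t + s)) \<longrightarrow>
    poly (pderiv ((\<Sum>q\<leftarrow>qs. q\<^sup>2) * g)) 0 \<le> \<eta> * b"
proof (cases "poly g 0 = 0")
  case True
  then show ?thesis
    using crit \<open>0 < \<eta>\<close> by (auto simp: pderiv_mult)
next
  case False
  define c c' where "c = poly g 0" and "c' = \<bar>poly (pderiv g) 0\<bar>"
  have "0 < c" and "0 \<le> c'"
    using False assms by (auto simp: c_def c'_def)
  have "\<forall>\<^sub>F s in at 0. c / 2 < poly g s"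
    using \<open>0 < c\<close> by (intro order_tendstoD(1)[OF tendsto_poly[OF tendsto_ident_at]]) (simp add: c_def)
  then obtain r where "0 < r" and r: "\<And>s. 0 < s \<Longrightarrow> s < r \<Longrightarrow> c / 2 < poly g s"
    by (auto simp: eventually_at dist_real_def)
  \<comment> \<open>The nodes lie below \<open>r\<close>, so that \<open>g\<close> exceeds
    \<open>c / 2\<close> there, and below 1, so that the assumed bound applies.\<close>
  have "infinite {0<..<min r 1}"
    using \<open>0 < r\<close> by (simp add: infinite_Ioo)
  then obtain A where A: "finite A" "card A = Suc d" "A \<subseteq> {0<..<min r 1}"
    using infinite_arbitrarily_large by blast
  obtain C where "0 \<le> C" and
    C: "\<And>q. degree q \<le> d \<Longrightarrow> (poly (pderiv q) 0)\<^sup>2 \<le> C * (\<Sum>s\<in>A. (poly q s)\<^sup>2)"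
    using pderiv_square_le_values[OF A(1), of d] A(2) by auto
  \<comment> \<open>\<open>K * b\<close> will bound the sum of the squared derivatives at 0; the
    summand 1 makes \<open>K\<close> positive. The weight \<open>e\<close> is then chosen such that
    \<open>c * e * (K * b)\<close> is half of \<open>\<eta> * b\<close>.\<close>
  define K where "K = C * (real (Suc d) * (4 / c)) + 1"
  have "0 < K"
    using \<open>0 \<le> C\<close> \<open>0 < c\<close> by (simp add: K_def add_nonneg_pos)
  define e where "e = \<eta> / (2 * K * c)"
  have "0 < e"
    using \<open>0 < K\<close> \<open>0 < c\<close> \<open>0 < \<eta>\<close> by (simp add: e_def)
  \<comment> \<open>\<open>M\<close> collects the factors of \<open>poly \<tau> 0 * c\<close>, which
    is at most \<open>b * t\<close>; for \<open>t < \<eta> / (2 * M)\<close> this costs the other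
    half.\<close>
  define M where "M = 1 / e + c' / c"
  have "0 < M"
    using \<open>0 < e\<close> \<open>0 < c\<close> \<open>0 \<le> c'\<close> by (simp add: M_def add_pos_nonneg)
  have "poly (pderiv ((\<Sum>q\<leftarrow>qs. q\<^sup>2) * g)) 0 \<le> \<eta> * b"
    if t: "0 < t" "t < min 1 (\<eta> / (2 * M))" and "0 < b" and deg: "\<forall>q\<in>set qs. degree q \<le> d"
      and bound: "\<forall>s\<in>{0..1}. poly ((\<Sum>q\<leftarrow>qs. q\<^sup>2) * g) s \<le> b * (t + s)" for t b qs
  proof -
    define \<tau> where "\<tau> = (\<Sum>q\<leftarrow>qs. q\<^sup>2)"
    define D where "D = (\<Sum>q\<leftarrow>qs. (poly (pderiv q) 0)\<^sup>2)"
    have \<tau>_nonneg: "0 \<le> poly \<tau> s" for s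
      unfolding \<tau>_def by (rule poly_sum_squares_nonneg)
    have "poly \<tau> s \<le> 4 / c * b" if "s \<in> A" for s
    proof -
      have s: "0 < s" "s < r" "s < 1"
        using that A(3) by auto
      have "poly \<tau> s * (c / 2) \<le> poly \<tau> s * poly g s"
        using r[OF s(1,2)] \<tau>_nonneg by (intro mult_left_mono) auto
      also have "\<dots> \<le> b * (t + s)"
        using bound s by (auto simp: \<tau>_def)
      also have "\<dots> \<le> b * 2"
        using s t \<open>0 < b\<close> by (intro mult_left_mono) auto
      finally show ?thesis
        using \<open>0 < c\<close> by (simp add: field_simps)
    qed
    then have "(\<Sum>s\<in>A. poly \<tau> s) \<le> real (Suc d) * (4 / c * b)"
      using sum_bounded_above[of A "poly \<tau>" "4 / c * b"] A(2) by simp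
    then have "C * (\<Sum>s\<in>A. poly \<tau> s) \<le> C * (real (Suc d) * (4 / c * b))"
      using \<open>0 \<le> C\<close> by (rule mult_left_mono)
    moreover have "D \<le> C * (\<Sum>s\<in>A. poly \<tau> s)"
      unfolding D_def \<tau>_def by (rule sum_squares_pderiv_le) (use deg C in auto)
    ultimately have D: "D \<le> K * b"
      using \<open>0 < b\<close> by (simp add: K_def algebra_simps)
    have \<tau>0: "poly \<tau> 0 * c \<le> b * t"
      using bound[rule_format, of 0] by (simp add: \<tau>_def c_def)
    have "poly (pderiv \<tau>) 0 \<le> poly \<tau> 0 / e + e * D"
      unfolding \<tau>_def D_def by (rule pderiv_sum_squares_le) fact
    then have 1: "c * poly (pderiv \<tau>) 0 \<le> c * (poly \<tau> 0 / e + e * D)"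
      using \<open>0 < c\<close> by (intro mult_left_mono) auto
    have 2: "poly \<tau> 0 * poly (pderiv g) 0 \<le> poly \<tau> 0 * c'"
      using \<tau>_nonneg by (intro mult_left_mono) (auto simp: c'_def)
    have "poly (pderiv (\<tau> * g)) 0 \<le> c * (poly \<tau> 0 / e + e * D) + poly \<tau> 0 * c'"
      using 1 2 by (simp add: pderiv_mult c_def)
    also have "\<dots> = poly \<tau> 0 * c * M + c * e * D"
      using \<open>0 < c\<close> by (simp add: M_def field_simps)
    also have "\<dots> \<le> b * t * M + c * e * (K * b)"
      using \<tau>0 D \<open>0 < M\<close> \<open>0 < c\<close> \<open>0 < e\<close> by (intro add_mono mult_right_mono mult_left_mono) auto
    also have "c * e * (K * b) = \<eta> / 2 * b"
      using \<open>0 < c\<close> \<open>0 < K\<close> by (simp add: e_def)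
    also have "b * t * M \<le> b * (\<eta> / 2)"
      using t \<open>0 < M\<close> \<open>0 < b\<close> by (auto simp: field_simps)
    finally show ?thesis
      by (simp add: \<tau>_def algebra_simps)
  qed
  moreover have "0 < min 1 (\<eta> / (2 * M))"
    using \<open>0 < M\<close> \<open>0 < \<eta>\<close> by simp
  ultimately show ?thesis
    unfolding eventually_at_right_field by blast
qed

section \<open>The truncated quadratic module\<close>

text \<open>Prepending the constant 1 to the generators treats the multiplier \<open>\<sigma>0\<close> like the others.\<close>

lemma quadratic_module_eval:
  fixes ps :: "'n::finite rpoly list"
  assumes "l \<in> quadratic_module ps d"
  shows "\<exists>Q. (\<forall>i<length (1 # ps). set (Q i) \<subseteq> polys_upto d) \<and>
    (\<forall>x. peval l x = (\<Sum>i<length (1 # ps). (\<Sum>q\<leftarrow>Q i. (peval q x)\<^sup>2) * peval ((1 # ps) ! i) x))"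
proof -
  obtain \<sigma>0 \<sigma> where l: "l = \<sigma>0 + (\<Sum>i<length ps. \<sigma> i * ps ! i)"
    and \<sigma>: "\<sigma>0 \<in> sos_upto d" "\<And>i. i < length ps \<Longrightarrow> \<sigma> i \<in> sos_upto d"
    using assms by (auto simp: quadratic_module_def)
  obtain qs where qs: "\<sigma>0 = (\<Sum>q\<leftarrow>qs. q\<^sup>2)" "set qs \<subseteq> polys_upto d"
    using \<sigma>(1) by (auto simp: sos_upto_def)
  have "\<exists>R. \<forall>i<length ps. \<sigma> i = (\<Sum>q\<leftarrow>R i. q\<^sup>2) \<and> set (R i) \<subseteq> polys_upto d"
    using \<sigma>(2) unfolding sos_upto_def by (intro choice) blast
  then obtain R where R: "\<And>i. i < length ps \<Longrightarrow> \<sigma> i = (\<Sum>q\<leftarrow>R i. q\<^sup>2)"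
    "\<And>i. i < length ps \<Longrightarrow> set (R i) \<subseteq> polys_upto d"
    by blast
  show ?thesis
  proof (intro exI[of _ "case_nat qs R"] conjI allI impI)
    show "set (case_nat qs R i) \<subseteq> polys_upto d" if "i < length (1 # ps)" for i
      using that qs R by (cases i) auto
    show "peval l x = (\<Sum>i<length (1 # ps).
        (\<Sum>q\<leftarrow>case_nat qs R i. (peval q x)\<^sup>2) * peval ((1 # ps) ! i) x)" for x
      unfolding l list.size add_Suc_right add_0_right
      by (subst sum.lessThan_Suc_shift) (simp add: qs R peval_sum peval_sum_list)
  qed
qed

lemma quadratic_module_nonneg:
  assumes "l \<in> quadratic_module ps d" "x \<in> basic_closed_set ps"
  shows "0 \<le> peval l x"
proof -
  obtain Q where Q: "\<And>x. peval l x =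
      (\<Sum>i<length (1 # ps). (\<Sum>q\<leftarrow>Q i. (peval q x)\<^sup>2) * peval ((1 # ps) ! i) x)"
    using quadratic_module_eval[OF assms(1)] by auto
  have "0 \<le> peval ((1 # ps) ! i) x" if "i < length (1 # ps)" for i
    using that assms(2) by (cases i) (auto simp: basic_closed_set_def)
  then show ?thesis
    unfolding Q by (intro sum_nonneg mult_nonneg_nonneg sum_list_nonneg) auto
qed

lemma basic_closed_set_subset_lasserre: "basic_closed_set ps \<subseteq> lasserre ps d"
  unfolding lasserre_def using quadratic_module_nonneg by blast

section \<open>Non-exposed faces\<close>

lemma nonexposed_face_witness:
  fixes S :: "'a::euclidean_space set"
  assumes "convex S" and F: "F face_of S" "F \<noteq> {}" "\<not> F exposed_face_of S"
  obtains x y where "x \<in> F" "y \<in> S - F"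
    "\<And>a b. \<lbrakk>\<And>z. z \<in> S \<Longrightarrow> b \<le> a \<bullet> z; a \<bullet> x = b\<rbrakk> \<Longrightarrow> a \<bullet> y = b"
proof -
  have "convex F" "F \<subseteq> S"
    using F(1) face_of_imp_convex face_of_imp_subset by blast+
  then obtain x where x: "x \<in> rel_interior F"
    using F(2) rel_interior_eq_empty by blast
  define \<E> where "\<E> = {T. T exposed_face_of S \<and> F \<subseteq> T}"
  \<comment> \<open>The intersection is exposed only if the family is nonempty.\<close>
  have "S \<in> \<E>"
    using assms(1) \<open>F \<subseteq> S\<close> by (simp add: \<E>_def)
  then have "\<Inter>\<E> exposed_face_of S"
    by (intro exposed_face_of_Inter) (blast, simp add: \<E>_def)
  then have "\<Inter>\<E> \<noteq> F"
    using F(3) by auto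
  moreover have "F \<subseteq> \<Inter>\<E>"
    by (auto simp: \<E>_def)
  ultimately obtain y where y: "y \<in> \<Inter>\<E>" "y \<notin> F"
    by blast
  show thesis
  proof (rule that)
    show "x \<in> F"
      using x rel_interior_subset by blast
    show "y \<in> S - F"
      using y \<open>S \<in> \<E>\<close> by auto
    fix a b
    assume ab: "\<And>z. z \<in> S \<Longrightarrow> b \<le> a \<bullet> z" "a \<bullet> x = b"
    let ?T = "S \<inter> {z. a \<bullet> z = b}"
    have T: "?T exposed_face_of S"
      using assms(1) ab(1) by (rule exposed_face_of_Int_supporting_hyperplane_ge)
    have "x \<in> ?T \<inter> rel_interior F"
      using x ab(2) \<open>F \<subseteq> S\<close> rel_interior_subset by blast
    \<comment> \<open>Here it matters that \<open>x\<close> is a relative interior point of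
      \<open>F\<close>: a supporting hyperplane through it contains all of \<open>F\<close>.\<close>
    then have "F \<subseteq> ?T"
      using T \<open>F \<subseteq> S\<close> by (intro subset_of_face_of[of ?T S]) (auto simp: exposed_face_of_def)
    with T have "?T \<in> \<E>"
      by (simp add: \<E>_def)
    then show "a \<bullet> y = b"
      using y(1) by auto
  qed
qed

text \<open>Convexity makes a generator that vanishes at \<open>x\<close> nonnegative along the segments from \<open>x\<close> into
  the set.\<close>

lemma gradient_supports:
  assumes "convex (basic_closed_set ps)" "p \<in> set ps"
    and "x \<in> basic_closed_set ps" "z \<in> basic_closed_set ps" "peval p x = 0"
    and a: "((peval p) has_derivative (\<lambda>h. a \<bullet> h)) (at x)"
  shows "a \<bullet> x \<le> a \<bullet> z"
proof (rule ccontr)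
  assume "\<not> a \<bullet> x \<le> a \<bullet> z"
  then have "poly (pderiv (line_poly x (z - x) p)) 0 < 0"
    by (simp add: pderiv_line_poly_0[OF a] inner_diff_right)
  then obtain e where "0 < e" and
    e: "\<And>h. 0 < h \<Longrightarrow> h < e \<Longrightarrow> poly (line_poly x (z - x) p) (0 + h) < poly (line_poly x (z - x) p) 0"
    using DERIV_neg_dec_right[OF poly_DERIV] by blast
  \<comment> \<open>The bound by 1 keeps the point on the segment from \<open>x\<close> to
    \<open>z\<close>.\<close>
  define h where "h = min (e / 2) 1"
  have h: "0 < h" "h < e" "h \<le> 1"
    using \<open>0 < e\<close> by (auto simp: h_def)
  have "(1 - h) *\<^sub>R x + h *\<^sub>R z \<in> basic_closed_set ps"
    using assms h by (intro convexD) auto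
  then have "0 \<le> peval p (x + h *\<^sub>R (z - x))"
    using assms(2) by (simp add: basic_closed_set_def algebra_simps)
  then show False
    using e[OF h(1,2)] assms(5) by (simp add: poly_line_poly)
qed

section \<open>Contradiction from an exact relaxation\<close>

theorem theorem4p2:
  fixes ps :: "'n::finite rpoly list"
  assumes "convex (basic_closed_set ps)"
    and "interior (basic_closed_set ps) \<noteq> {}"
    and "has_nonexposed_face (basic_closed_set ps)"
  shows "\<forall>d. basic_closed_set ps \<subset> lasserre ps d"
proof (intro allI psubsetI basic_closed_set_subset_lasserre notI)
  fix d
  assume exact: "basic_closed_set ps = lasserre ps d"
  define S where "S = basic_closed_set ps"
  obtain F where F: "F face_of S" "F \<noteq> {}" "\<not> F exposed_face_of S"
    using assms(3) by (auto simp: has_nonexposed_face_def S_def)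
  obtain x y where x: "x \<in> F" and y: "y \<in> S - F" and
    flat: "\<And>a b. \<lbrakk>\<And>z. z \<in> S \<Longrightarrow> b \<le> a \<bullet> z; a \<bullet> x = b\<rbrakk> \<Longrightarrow> a \<bullet> y = b"
    using nonexposed_face_witness[OF assms(1)[folded S_def] F] by blast
  have "x \<in> S"
    using x F(1) face_of_imp_subset by blast
  define v where "v = y - x"
  define ps' where "ps' = 1 # ps"
  define N where "N = length ps'"
  define g where "g i = line_poly x v (ps' ! i)" for i
  \<comment> \<open>With this value, \<open>N\<close> bounds of the form \<open>\<eta> * b\<close>
    add up to less than \<open>b\<close>.\<close>
  define \<eta> where "\<eta> = 1 / (real N + 1)"
  have "0 < \<eta>"
    by (simp add: \<eta>_def add_nonneg_pos)
  have S_nonneg: "0 \<le> peval (ps' ! i) z" if "i < N" "z \<in> S" for i z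
    using that by (cases i) (auto simp: N_def ps'_def S_def basic_closed_set_def)
  have segment: "x + s *\<^sub>R v \<in> S" if "s \<in> {0..1}" for s
  proof -
    have "(1 - s) *\<^sub>R x + s *\<^sub>R y \<in> S"
      using assms(1) \<open>x \<in> S\<close> y that by (intro convexD) (auto simp: S_def)
    then show ?thesis
      by (simp add: v_def algebra_simps)
  qed
  have g_nonneg: "0 \<le> poly (g i) s" if "i < N" "s \<in> {0..1}" for i s
    using S_nonneg[OF that(1) segment[OF that(2)]] by (simp add: g_def poly_line_poly)
  have g_crit: "poly (pderiv (g i)) 0 = 0" if i: "i < N" "poly (g i) 0 = 0" for i
  proof -
    define p where "p = ps' ! i"
    have px: "peval p x = 0"
      using i(2) by (simp add: g_def poly_line_poly p_def)
    \<comment> \<open>The prepended generator 1 has no zero, so \<open>p\<close> is one of the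
      original ones.\<close>
    then have "p \<in> set ps"
      using i(1) by (cases i) (auto simp: p_def N_def ps'_def)
    obtain a where a: "((peval p) has_derivative (\<lambda>h. a \<bullet> h)) (at x)"
      by (rule peval_has_gradient)
    have "a \<bullet> y = a \<bullet> x"
      using assms(1) \<open>p \<in> set ps\<close> \<open>x \<in> S\<close> px a by (intro flat gradient_supports) (auto simp: S_def)
    then show ?thesis
      using pderiv_line_poly_0[OF a, of v] by (simp add: g_def p_def v_def inner_diff_right)
  qed
  \<comment> \<open>All \<open>qs\<close> and \<open>b\<close> are covered at once, because
    \<open>t\<close> is fixed before the affine polynomial \<open>l\<close> whose representation
    provides them.\<close>
  define small where "small t i \<longleftrightarrow> (\<forall>qs b. 0 < b \<longrightarrow> (\<forall>q\<in>set qs. degree q \<le> d) \<longrightarrow>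
    (\<forall>s\<in>{0..1}. poly ((\<Sum>q\<leftarrow>qs. q\<^sup>2) * g i) s \<le> b * (t + s)) \<longrightarrow>
    poly (pderiv ((\<Sum>q\<leftarrow>qs. q\<^sup>2) * g i)) 0 \<le> \<eta> * b)" for t :: real and i
  have "\<forall>\<^sub>F t in at_right 0. small t i" if "i < N" for i
    unfolding small_def using that g_nonneg g_crit \<open>0 < \<eta>\<close>
    by (intro weighted_sos_pderiv_small) auto
  then have "\<forall>\<^sub>F t in at_right 0. \<forall>i\<in>{..<N}. small t i"
    by (intro eventually_ball_finite) auto
  then have "\<forall>\<^sub>F t in at_right 0. 0 < t \<and> (\<forall>i\<in>{..<N}. small t i)"
    using eventually_at_right_less[of "0 :: real"] by (simp add: eventually_conj)
  from eventually_happens'[OF trivial_limit_at_right_real this]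
  obtain t where "0 < t" and small: "\<And>i. i < N \<Longrightarrow> small t i"
    by auto
  \<comment> \<open>Otherwise \<open>x\<close> would lie strictly between two points of
    \<open>S\<close>, and the face \<open>F\<close> would contain \<open>y\<close>.\<close>
  have "x - t *\<^sub>R v \<notin> S"
  proof
    assume "x - t *\<^sub>R v \<in> S"
    moreover have "x \<in> open_segment (x - t *\<^sub>R v) y"
    proof -
      have "x = (1 - t / (1 + t)) *\<^sub>R (x - t *\<^sub>R v) + (t / (1 + t)) *\<^sub>R y"
      proof -
        have "(1 - t / (1 + t)) *\<^sub>R (x - t *\<^sub>R v) + (t / (1 + t)) *\<^sub>R y
            = x + (t / (1 + t) - (1 - t / (1 + t)) * t) *\<^sub>R v"
          by (simp add: v_def algebra_simps)
        also have "t / (1 + t) - (1 - t / (1 + t)) * t = 0"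
          using \<open>0 < t\<close> by (simp add: field_simps)
        finally show ?thesis by simp
      qed
      moreover have "x - t *\<^sub>R v \<noteq> y"
      proof
        assume "x - t *\<^sub>R v = y"
        then have "(1 + t) *\<^sub>R v = 0"
          by (simp add: v_def algebra_simps)
        then show False
          using \<open>0 < t\<close> x y by (auto simp: v_def)
      qed
      moreover have "0 < t / (1 + t)" "t / (1 + t) < 1"
        using \<open>0 < t\<close> by auto
      ultimately show ?thesis
        unfolding in_segment by blast
    qed
    ultimately show False
      using face_ofD[OF F(1)] x y by blast
  qed
  then obtain l where l: "l \<in> quadratic_module ps d" "l \<in> polys_upto 1" "peval l (x - t *\<^sub>R v) < 0"
    using exact by (auto simp: S_def lasserre_def not_le)
  define h where "h = line_poly x v l"
  have "degree h \<le> 1"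
    unfolding h_def by (rule degree_line_poly_le) (rule l)
  define a b where "a = coeff h 0" and "b = coeff h 1"
  have h: "h = [:a, b:]"
    using \<open>degree h \<le> 1\<close>
    by (intro poly_eqI) (auto simp: a_def b_def coeff_pCons coeff_eq_0 split: nat.split)
  have h_eval: "a + s * b = peval l (x + s *\<^sub>R v)" for s
    using poly_line_poly[of x v l s] by (simp add: h flip: h_def)
  have "0 \<le> a"
    using h_eval[of 0] quadratic_module_nonneg[OF l(1)] \<open>x \<in> S\<close> by (simp add: S_def)
  moreover have "a < b * t"
    using h_eval[of "- t"] l(3) by (simp add: mult.commute)
  ultimately have "0 < b"
    using \<open>0 < t\<close> by (metis order_le_less_trans zero_less_mult_pos2)
  obtain Q where Q: "\<And>i. i < N \<Longrightarrow> set (Q i) \<subseteq> polys_upto d"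
    and l_eval: "\<And>x. peval l x = (\<Sum>i<N. (\<Sum>q\<leftarrow>Q i. (peval q x)\<^sup>2) * peval (ps' ! i) x)"
    using quadratic_module_eval[OF l(1), folded ps'_def, folded N_def] by auto
  define f where "f i = (\<Sum>q\<leftarrow>map (line_poly x v) (Q i). q\<^sup>2) * g i" for i
  have "poly (\<Sum>q\<leftarrow>qs. (line_poly x v q)\<^sup>2) s = (\<Sum>q\<leftarrow>qs. (peval q (x + s *\<^sub>R v))\<^sup>2)" for qs s
    by (induction qs) (auto simp: poly_line_poly)
  then have "poly h s = poly (\<Sum>i<N. f i) s" for s
    by (simp add: h_def poly_line_poly l_eval poly_sum f_def g_def o_def)
  then have hf: "h = (\<Sum>i<N. f i)"
    using poly_eq_poly_eq_iff by blast
  have f_nonneg: "0 \<le> poly (f i) s" if "i < N" "s \<in> {0..1}" for i s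
    unfolding f_def poly_mult using g_nonneg[OF that] poly_sum_squares_nonneg by (rule mult_nonneg_nonneg[rotated])
  have f_le: "poly (f i) s \<le> b * (t + s)" if "i < N" "s \<in> {0..1}" for i s
  proof -
    \<comment> \<open>One of several nonnegative summands is at most their sum, which is
      \<open>h\<close> at \<open>s\<close>.\<close>
    have "poly (f i) s \<le> (\<Sum>i<N. poly (f i) s)"
      using that f_nonneg by (intro member_le_sum) auto
    also have "\<dots> = a + s * b"
      using h by (simp add: hf flip: poly_sum)
    finally show ?thesis
      using \<open>a < b * t\<close> by (simp add: algebra_simps)
  qed
  have "b = (\<Sum>i<N. poly (pderiv (f i)) 0)"
  proof -
    have "pderiv h = (\<Sum>i<N. pderiv (f i))"
      using higher_pderiv_sum[of 1 f "{..<N}"] by (simp add: hf)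
    then have "poly (pderiv h) 0 = (\<Sum>i<N. poly (pderiv (f i)) 0)"
      by (simp only: poly_sum)
    then show ?thesis
      by (simp add: h pderiv_pCons)
  qed
  also have "\<dots> \<le> (\<Sum>i<N. \<eta> * b)"
  proof (rule sum_mono)
    fix i assume "i \<in> {..<N}"
    then have i: "i < N" by simp
    have "\<forall>q\<in>set (map (line_poly x v) (Q i)). degree q \<le> d"
      using Q[OF i] by (auto intro!: degree_line_poly_le)
    moreover have "\<forall>s\<in>{0..1}. poly (f i) s \<le> b * (t + s)"
      using f_le[OF i] by simp
    ultimately show "poly (pderiv (f i)) 0 \<le> \<eta> * b"
      using small[OF i] \<open>0 < b\<close> unfolding small_def f_def by blast
  qed
  also have "\<dots> = real N / (real N + 1) * b"
    by (simp add: \<eta>_def)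
  also have "\<dots> < 1 * b"
    using \<open>0 < b\<close> by (intro mult_strict_right_mono) auto
  finally show False by simp
qed

end
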